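(* For every integer $s \ge 2$, $$R(3,s+1) \ge R(3,K_s-e) + 4.$$
   Context: All graphs are finite, simple and undirected. For graphs $G$ and $H$, the Ramsey number $R(G,H)$ is the smallest positive integer $n$ such that every coloring of the edges of the complete graph $K_n$ with two colors contains a copy of $G$ (as a not necessarily induced subgraph) in the first color or a copy of $H$ in the second color. Equivalently, it is the smallest $n$ such that every graph on $n$ vertices with no subgraph $G$ contains $H$ as a subgraph of its complement. When $G=K_s$ or $H=K_t$ we write $s$ or $t$ in its place, so $R(3,H)=R(K_3,H)$ and $R(3,s)=R(K_3,K_s)$. $K_s-e$ denotes the complete graph on $s$ vertices with one edge removed (all $s$ vertices are kept). *)

theory Defs
  imports "HOL-Library.Ramsey"
begin

text \<open>
  A graph is a pair of a vertex set and an edge set; an edge is a two-element set of vertices.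
\<close>

type_synonym 'a graph = "'a set \<times> 'a set set"

abbreviation verts :: "'a graph \<Rightarrow> 'a set" where
  "verts G \<equiv> fst G"

abbreviation edges :: "'a graph \<Rightarrow> 'a set set" where
  "edges G \<equiv> snd G"

definition simple_graph :: "'a graph \<Rightarrow> bool" where
  "simple_graph G \<longleftrightarrow> finite (verts G) \<and> edges G \<subseteq> [verts G]\<^bsup>2\<^esup>"

definition complete_graph :: "nat \<Rightarrow> nat graph" where
  "complete_graph n = ({..<n}, [{..<n}]\<^bsup>2\<^esup>)"

definition delete_edge :: "'a graph \<Rightarrow> 'a set \<Rightarrow> 'a graph" where
  "delete_edge G e = (verts G, edges G - {e})"

text \<open>
  A copy of \<open>G\<close> in \<open>H\<close> is a not necessarily induced subgraph of \<open>H\<close> isomorphic to \<open>G\<close>,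
  given by an embedding of \<open>G\<close>; isolated vertices of \<open>G\<close> have to be embedded as well.
\<close>

definition contains_copy :: "'b graph \<Rightarrow> 'a graph \<Rightarrow> bool" where
  "contains_copy H G \<longleftrightarrow>
     (\<exists>f. inj_on f (verts G) \<and> f ` verts G \<subseteq> verts H \<and> (\<forall>e\<in>edges G. f ` e \<in> edges H))"

text \<open>
  The spanning subgraph formed by the edges of colour \<open>i\<close> under the edge colouring \<open>c\<close>;
  the first colour is \<open>True\<close> and the second is \<open>False\<close>.
\<close>

definition colour_class :: "'a graph \<Rightarrow> ('a set \<Rightarrow> bool) \<Rightarrow> bool \<Rightarrow> 'a graph" where
  "colour_class G c i = (verts G, {e \<in> edges G. c e = i})"

definition arrows :: "nat \<Rightarrow> 'a graph \<Rightarrow> 'b graph \<Rightarrow> bool" where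
  "arrows n G H \<longleftrightarrow>
     (\<forall>c. contains_copy (colour_class (complete_graph n) c True) G \<or>
          contains_copy (colour_class (complete_graph n) c False) H)"

definition ramsey_number :: "'a graph \<Rightarrow> 'b graph \<Rightarrow> nat" where
  "ramsey_number G H = (LEAST n. n \<ge> 1 \<and> arrows n G H)"

text \<open>The least number above exists for all finite simple graphs.\<close>

lemma contains_copy_if_clique:
  fixes G :: "'a graph" and H :: "'b graph"
  assumes G: "simple_graph G"
    and R: "R \<subseteq> verts H" "finite R" "card R = card (verts G)" "[R]\<^bsup>2\<^esup> \<subseteq> edges H"
  shows "contains_copy H G"
proof -
  have "finite (verts G)" using G by (simp add: simple_graph_def)
  then obtain f where f: "bij_betw f (verts G) R"
    using R finite_same_card_bij by metis
  then have inj: "inj_on f (verts G)" and im: "f ` verts G = R"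
    by (auto simp: bij_betw_def)
  have "f ` e \<in> edges H" if "e \<in> edges G" for e
  proof -
    have e: "e \<subseteq> verts G" "finite e" "card e = 2"
      using G that by (auto simp: simple_graph_def nsets_def)
    then have "card (f ` e) = 2"
      using inj by (metis card_image inj_on_subset)
    then have "f ` e \<in> [R]\<^bsup>2\<^esup>"
      using e im by (auto simp: nsets_def)
    then show ?thesis using R(4) by blast
  qed
  then show ?thesis
    using inj im R(1) unfolding contains_copy_def by blast
qed

lemma arrows_exists:
  fixes G :: "'a graph" and H :: "'b graph"
  assumes G: "simple_graph G" and H: "simple_graph H"
  shows "\<exists>n\<ge>1. arrows n G H"
proof -
  obtain r where r: "r \<ge> 1"
    and ram: "\<And>(V::nat set) E. finite V \<and> card V \<ge> r \<Longrightarrow>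
      \<exists>R\<subseteq>V. card R = card (verts G) \<and> clique R E \<or> card R = card (verts H) \<and> indep R E"
    using ramsey2[of "card (verts G)" "card (verts H)"] by metis
  have "contains_copy (colour_class (complete_graph r) c True) G \<or>
        contains_copy (colour_class (complete_graph r) c False) H" for c
  proof -
    obtain R where R: "R \<subseteq> {..<r}"
      and *: "card R = card (verts G) \<and> clique R {e. c e} \<or>
              card R = card (verts H) \<and> indep R {e. c e}"
      using ram[of "{..<r}" "{e. c e}"] by auto
    have fin: "finite R" using R finite_subset by blast
    from * show ?thesis
    proof
      assume A: "card R = card (verts G) \<and> clique R {e. c e}"
      then have "[R]\<^bsup>2\<^esup> \<subseteq> edges (colour_class (complete_graph r) c True)"
        using R by (auto simp: colour_class_def complete_graph_def nsets_def clique_def card_2_iff)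
      then show ?thesis
        using A R fin contains_copy_if_clique[OF G, of R]
        by (simp add: colour_class_def complete_graph_def)
    next
      assume A: "card R = card (verts H) \<and> indep R {e. c e}"
      then have "[R]\<^bsup>2\<^esup> \<subseteq> edges (colour_class (complete_graph r) c False)"
        using R by (auto simp: colour_class_def complete_graph_def nsets_def indep_def card_2_iff)
      then show ?thesis
        using A R fin contains_copy_if_clique[OF H, of R]
        by (simp add: colour_class_def complete_graph_def)
    qed
  qed
  then show ?thesis using r unfolding arrows_def by blast
qed

lemma simple_graph_complete: "simple_graph (complete_graph n)"
  by (simp add: simple_graph_def complete_graph_def)

lemma simple_graph_delete_edge: "simple_graph G \<Longrightarrow> simple_graph (delete_edge G e)"
  by (auto simp: simple_graph_def delete_edge_def)

end

theory Submission
  imports Defs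
begin

text \<open>
  A colouring of \<open>K\<^sub>m\<close> avoiding \<open>K\<^sub>3\<close> and \<open>K\<^sub>s - e\<close> is extended by four vertices. Choose an edge
  \<open>uv\<close> of the first colour, replace \<open>u\<close> and \<open>v\<close> by two copies each, \<open>u, u'\<close> and \<open>v, v'\<close>, joined
  by the cross edges \<open>uv'\<close> and \<open>u'v\<close> only, and add two adjacent vertices \<open>w, w'\<close> with \<open>w\<close> joined
  to \<open>u, v\<close> and \<open>w'\<close> joined to \<open>u', v'\<close>. No triangle arises. The four events that an independent
  set \<open>I\<close> contains \<open>{u, u'}\<close>, contains \<open>{v, v'}\<close>, contains \<open>w\<close>, or contains \<open>w'\<close>
  are mutually exclusive, so deleting one vertex from \<open>I\<close> leaves a set that projects
  injectively to \<open>K\<^sub>m\<close>, where its image spans at most the edge \<open>uv\<close>. Hence \<open>I\<close> has at most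
  \<open>s\<close> vertices. If the first colour has no edge, then \<open>m < s\<close>, and for \<open>m \<ge> 2\<close> any pair may be
  recoloured; for \<open>m < 2\<close> the pentagon shows that \<open>R(3, s + 1) > 5\<close>.
\<close>

section \<open>Colourings, independent sets and embeddings\<close>

definition triangle_free :: "nat \<Rightarrow> (nat set \<Rightarrow> bool) \<Rightarrow> bool" where
  "triangle_free n c \<longleftrightarrow>
    (\<forall>x<n. \<forall>y<n. \<forall>z<n. x \<noteq> y \<longrightarrow> y \<noteq> z \<longrightarrow> x \<noteq> z \<longrightarrow> c {x, y} \<longrightarrow> c {y, z} \<longrightarrow> \<not> c {x, z})"

definition independent :: "(nat set \<Rightarrow> bool) \<Rightarrow> nat set \<Rightarrow> bool" where
  "independent c I \<longleftrightarrow> (\<forall>x\<in>I. \<forall>y\<in>I. x \<noteq> y \<longrightarrow> \<not> c {x, y})"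

text \<open>Such a set of \<open>s\<close> vertices carries a copy of the complete graph minus an
  edge in the second colour. The pair \<open>{a, b}\<close> stands for the deleted edge and may have
  either colour, since copies need not be induced.\<close>

definition near_independent :: "(nat set \<Rightarrow> bool) \<Rightarrow> nat set \<Rightarrow> bool" where
  "near_independent c I \<longleftrightarrow> (\<exists>a\<in>I. \<exists>b\<in>I. a \<noteq> b \<and>
    (\<forall>x\<in>I. \<forall>y\<in>I. x \<noteq> y \<longrightarrow> {x, y} \<noteq> {a, b} \<longrightarrow> \<not> c {x, y}))"

text \<open>Any two elements can serve as the exempt pair; the bound on the cardinality makes sure
  that there are two.\<close>

lemma independent_imp_near_independent:
  assumes "independent c I" "card I \<ge> 2"
  shows "near_independent c I"
proof -
  obtain T where "T \<subseteq> I" "card T = 2"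
    using obtain_subset_with_card_n[OF assms(2)] by metis
  then obtain a b where "a \<in> I" "b \<in> I" "a \<noteq> b"
    by (auto simp: card_2_iff)
  then show ?thesis
    using assms(1) unfolding near_independent_def independent_def by blast
qed

lemma edges_complete_graph_iff: "e \<in> edges (complete_graph n) \<longleftrightarrow> (\<exists>x<n. \<exists>y<n. x \<noteq> y \<and> e = {x, y})"
  by (auto simp: complete_graph_def nsets_def card_2_iff)

lemma edges_colour_class_iff:
  "e \<in> edges (colour_class (complete_graph n) c i) \<longleftrightarrow>
    (\<exists>x<n. \<exists>y<n. x \<noteq> y \<and> e = {x, y}) \<and> c e = i"
  by (simp add: colour_class_def edges_complete_graph_iff[symmetric])

lemma verts_colour_class [simp]: "verts (colour_class (complete_graph n) c i) = {..<n}"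
  by (simp add: colour_class_def complete_graph_def)

lemma verts_complete_graph [simp]: "verts (complete_graph n) = {..<n}"
  by (simp add: complete_graph_def)

lemma contains_complete_graph_iff:
  "contains_copy (colour_class (complete_graph n) c i) (complete_graph k) \<longleftrightarrow>
    (\<exists>R\<subseteq>{..<n}. card R = k \<and> (\<forall>x\<in>R. \<forall>y\<in>R. x \<noteq> y \<longrightarrow> c {x, y} = i))"
proof
  assume "contains_copy (colour_class (complete_graph n) c i) (complete_graph k)"
  then obtain f where inj: "inj_on f {..<k}" and im: "f ` {..<k} \<subseteq> {..<n}"
    and ed: "\<And>e. e \<in> edges (complete_graph k) \<Longrightarrow> f ` e \<in> edges (colour_class (complete_graph n) c i)"
    by (auto simp: contains_copy_def)
  have "c {f a, f b} = i" if "a < k" "b < k" "f a \<noteq> f b" for a b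
    using ed[of "{a, b}"] that by (auto simp: edges_complete_graph_iff edges_colour_class_iff)
  then show "\<exists>R\<subseteq>{..<n}. card R = k \<and> (\<forall>x\<in>R. \<forall>y\<in>R. x \<noteq> y \<longrightarrow> c {x, y} = i)"
    using im card_image[OF inj] by (intro exI[of _ "f ` {..<k}"]) auto
next
  assume "\<exists>R\<subseteq>{..<n}. card R = k \<and> (\<forall>x\<in>R. \<forall>y\<in>R. x \<noteq> y \<longrightarrow> c {x, y} = i)"
  then obtain R where R: "R \<subseteq> {..<n}" "card R = k" "\<forall>x\<in>R. \<forall>y\<in>R. x \<noteq> y \<longrightarrow> c {x, y} = i"
    by blast
  have "[R]\<^bsup>2\<^esup> \<subseteq> edges (colour_class (complete_graph n) c i)"
  proof
    fix e assume "e \<in> [R]\<^bsup>2\<^esup>"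
    then obtain x y where "e = {x, y}" "x \<noteq> y" "x \<in> R" "y \<in> R"
      by (auto simp: nsets_def card_2_iff)
    then show "e \<in> edges (colour_class (complete_graph n) c i)"
      using R unfolding edges_colour_class_iff by blast
  qed
  then show "contains_copy (colour_class (complete_graph n) c i) (complete_graph k)"
    using R finite_subset[OF R(1)]
    by (intro contains_copy_if_clique[OF simple_graph_complete, of R]) auto
qed

lemma contains_triangle_iff:
  "contains_copy (colour_class (complete_graph n) c True) (complete_graph 3) \<longleftrightarrow> \<not> triangle_free n c"
proof -
  have "(\<exists>R\<subseteq>{..<n}. card R = 3 \<and> (\<forall>x\<in>R. \<forall>y\<in>R. x \<noteq> y \<longrightarrow> c {x, y})) \<longleftrightarrow> \<not> triangle_free n c"
  proof
    assume "\<exists>R\<subseteq>{..<n}. card R = 3 \<and> (\<forall>x\<in>R. \<forall>y\<in>R. x \<noteq> y \<longrightarrow> c {x, y})"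
    then obtain x y z where "{x, y, z} \<subseteq> {..<n}" "x \<noteq> y" "y \<noteq> z" "x \<noteq> z"
      "c {x, y}" "c {y, z}" "c {x, z}"
      by (auto simp: card_3_iff)
    then show "\<not> triangle_free n c"
      by (auto simp: triangle_free_def)
  next
    assume "\<not> triangle_free n c"
    then obtain x y z where "x < n" "y < n" "z < n" "x \<noteq> y" "y \<noteq> z" "x \<noteq> z"
      "c {x, y}" "c {y, z}" "c {x, z}"
      by (auto simp: triangle_free_def)
    then show "\<exists>R\<subseteq>{..<n}. card R = 3 \<and> (\<forall>x\<in>R. \<forall>y\<in>R. x \<noteq> y \<longrightarrow> c {x, y})"
      by (intro exI[of _ "{x, y, z}"]) (auto simp: insert_commute)
  qed
  then show ?thesis
    by (simp add: contains_complete_graph_iff)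
qed

lemma arrows_complete_graph_iff:
  "arrows n (complete_graph 3) (complete_graph k) \<longleftrightarrow>
    (\<forall>c. triangle_free n c \<longrightarrow> (\<exists>I\<subseteq>{..<n}. card I = k \<and> independent c I))"
  unfolding arrows_def contains_triangle_iff contains_complete_graph_iff[of _ _ False] independent_def
  by auto

text \<open>Send \<open>e\<close> onto the exempt pair \<open>{a, b}\<close> and the other vertices
  anywhere bijectively. By injectivity every other edge lands on a pair different from
  \<open>{a, b}\<close>, which has the second colour. Hence it does not matter which edge is
  deleted.\<close>

lemma contains_delete_edge:
  assumes e: "e \<in> edges (complete_graph k)"
    and I: "I \<subseteq> {..<n}" "card I = k" "near_independent c I"
  shows "contains_copy (colour_class (complete_graph n) c False) (delete_edge (complete_graph k) e)"
proof -
  obtain p q where pq: "p < k" "q < k" "p \<noteq> q" "e = {p, q}"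
    using e by (auto simp: edges_complete_graph_iff)
  obtain a b where ab: "a \<in> I" "b \<in> I" "a \<noteq> b"
    and ind: "\<forall>x\<in>I. \<forall>y\<in>I. x \<noteq> y \<longrightarrow> {x, y} \<noteq> {a, b} \<longrightarrow> \<not> c {x, y}"
    using I(3) unfolding near_independent_def by (elim bexE conjE) (rule that)
  have "finite I"
    using I(1) finite_subset by blast
  have "card ({..<k} - {p, q}) = card (I - {a, b})"
    using pq ab I(2) by (simp add: card_Diff_subset)
  then obtain h where h: "bij_betw h ({..<k} - {p, q}) (I - {a, b})"
    using finite_same_card_bij \<open>finite I\<close> by (metis finite_Diff finite_lessThan)
  define f where "f = (\<lambda>x. if x = p then a else if x = q then b else h x)"
  have "bij_betw f ({..<k} - {p, q}) (I - {a, b})"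
    using h by (rule bij_betw_cong[THEN iffD1, rotated]) (auto simp: f_def)
  moreover have "bij_betw f {p, q} {a, b}"
    using pq ab by (auto simp: bij_betw_def f_def inj_on_def)
  ultimately have "bij_betw f (({..<k} - {p, q}) \<union> {p, q}) ((I - {a, b}) \<union> {a, b})"
    by (rule bij_betw_combine) auto
  moreover have "({..<k} - {p, q}) \<union> {p, q} = {..<k}" "(I - {a, b}) \<union> {a, b} = I"
    using pq ab by auto
  ultimately have "bij_betw f {..<k} I"
    by metis
  then have f: "inj_on f {..<k}" "f ` {..<k} = I"
    by (simp_all add: bij_betw_def)
  have fe: "f ` e = {a, b}"
    using pq by (auto simp: f_def)
  have "f ` d \<in> edges (colour_class (complete_graph n) c False)"
    if d: "d \<in> edges (complete_graph k)" "d \<noteq> e" for d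
  proof -
    obtain x y where xy: "x < k" "y < k" "x \<noteq> y" "d = {x, y}"
      using d by (auto simp: edges_complete_graph_iff)
    have fxy: "f x \<in> I" "f y \<in> I" "f x \<noteq> f y"
      using f xy by (auto dest: inj_onD)
    have "f ` d \<noteq> f ` e"
      using inj_on_image_eq_iff[OF f(1), of d e] d xy pq by auto
    then have "{f x, f y} \<noteq> {a, b}"
      using fe xy by simp
    then have "\<not> c {f x, f y}"
      using ind fxy by simp
    then show ?thesis
      using fxy I(1) xy by (auto simp: edges_colour_class_iff)
  qed
  then show ?thesis
    unfolding contains_copy_def using f I(1)
    by (intro exI[of _ f]) (auto simp: delete_edge_def)
qed

section \<open>The extension by four vertices\<close>

lemma extend_by_four:
  assumes tf: "triangle_free m c"
    and J: "\<And>I. I \<subseteq> {..<m} \<Longrightarrow> card I = s \<Longrightarrow> \<not> near_independent c I"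
    and uv: "u < m" "v < m" "u \<noteq> v" "c {u, v}" and s: "s \<ge> 2"
  shows "\<exists>c'. triangle_free (m + 4) c' \<and> (\<forall>I\<subseteq>{..<m + 4}. card I = s + 1 \<longrightarrow> \<not> independent c' I)"
proof -
  \<comment> \<open>The vertices \<open>m\<close> and \<open>m + 1\<close> are the copies u' of
    \<open>u\<close> and v' of \<open>v\<close>, and \<open>m + 2\<close> and \<open>m + 3\<close>
    are w and w'. The map \<open>\<pi>\<close> sends each copy to its original; \<open>F\<close>
    consists of the edges at w or w'.\<close>
  define \<pi> where "\<pi> = (\<lambda>x. if x = m then u else if x = m + 1 then v else x)"
  define F where "F = {{u, m + 2}, {v, m + 2}, {m, m + 3}, {m + 1, m + 3}, {m + 2, m + 3}}"
  \<comment> \<open>The cardinality condition separates the two copies of one vertex. The last two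
    conditions remove uv and u'v', so that only the cross edges remain between the copies.\<close>
  define c' where "c' = (\<lambda>e. e \<in> F \<or> e \<subseteq> {..<m + 2} \<and> card (\<pi> ` e) = 2 \<and> c (\<pi> ` e)
    \<and> e \<noteq> {u, v} \<and> e \<noteq> {m, m + 1})"
  have low: "c' {x, y} \<longleftrightarrow> \<pi> x \<noteq> \<pi> y \<and> c {\<pi> x, \<pi> y} \<and> {x, y} \<noteq> {u, v} \<and> {x, y} \<noteq> {m, m + 1}"
    if "x < m + 2" "y < m + 2" for x y
    using that uv by (auto simp: c'_def F_def card_insert_if doubleton_eq_iff)
  have w: "c' {m + 2, x} \<longleftrightarrow> x = u \<or> x = v \<or> x = m + 3" for x
    using uv by (auto simp: c'_def F_def doubleton_eq_iff)
  have w': "c' {m + 3, x} \<longleftrightarrow> x = m \<or> x = m + 1 \<or> x = m + 2" for x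
    using uv by (auto simp: c'_def F_def doubleton_eq_iff)
  have pi: "\<pi> x < m" if "x < m + 2" for x
    using that uv by (auto simp: \<pi>_def)
  have copies: "\<not> c' {u, v}" "\<not> c' {m, m + 1}" "c' {u, m + 1}" "c' {v, m}"
    using low uv by (auto simp: \<pi>_def insert_commute doubleton_eq_iff)
  \<comment> \<open>The neighbourhoods \<open>{u, v, m + 3}\<close> of w and
    \<open>{m, m + 1, m + 2}\<close> of w' span no edge of \<open>c'\<close>. Any triangle therefore
    avoids both vertices, and \<open>\<pi>\<close> maps it to a triangle of
    \<open>c\<close>.\<close>
  have no_triangle_at: "\<not> c' {y, z}" if "c' {x, y}" "c' {x, z}" "y \<noteq> z" "x \<in> {m + 2, m + 3}" for x y z
    using that w w' copies uv by (auto simp: insert_commute)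
  have "triangle_free (m + 4) c'"
    unfolding triangle_free_def
  proof (intro allI impI notI)
    fix x y z
    assume xyz: "x < m + 4" "y < m + 4" "z < m + 4" "x \<noteq> y" "y \<noteq> z" "x \<noteq> z"
      and e: "c' {x, y}" "c' {y, z}" "c' {x, z}"
    have "x \<notin> {m + 2, m + 3}" "y \<notin> {m + 2, m + 3}" "z \<notin> {m + 2, m + 3}"
      using no_triangle_at[of x y z] no_triangle_at[of y x z] no_triangle_at[of z x y] e xyz
      by (auto simp: insert_commute)
    then have "x < m + 2" "y < m + 2" "z < m + 2"
      using xyz by auto
    then have "\<pi> x < m" "\<pi> y < m" "\<pi> z < m"
      and "\<pi> x \<noteq> \<pi> y" "\<pi> y \<noteq> \<pi> z" "\<pi> x \<noteq> \<pi> z"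
      and "c {\<pi> x, \<pi> y}" "c {\<pi> y, \<pi> z}" "c {\<pi> x, \<pi> z}"
      using e pi low by simp_all
    then show False
      using tf unfolding triangle_free_def by blast
  qed
  moreover have "\<not> independent c' I" if I: "I \<subseteq> {..<m + 4}" "card I = s + 1" for I
  proof
    assume ind: "independent c' I"
    have excl: "\<not> (x \<in> I \<and> y \<in> I)" if "c' {x, y}" "x \<noteq> y" for x y
      using ind that by (auto simp: independent_def)
    have "finite I" "I \<noteq> {}"
      using I finite_subset by auto
    have "\<exists>x\<in>I. I - {x} \<subseteq> {..<m + 2} \<and> inj_on \<pi> (I - {x})"
    proof -
      have ex: "\<not> (u \<in> I \<and> m + 1 \<in> I)" "\<not> (v \<in> I \<and> m \<in> I)" "\<not> (m + 2 \<in> I \<and> u \<in> I)"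
        "\<not> (m + 2 \<in> I \<and> v \<in> I)" "\<not> (m + 2 \<in> I \<and> m + 3 \<in> I)"
        "\<not> (m + 3 \<in> I \<and> m \<in> I)" "\<not> (m + 3 \<in> I \<and> m + 1 \<in> I)"
        using copies w w' uv by (intro excl; simp)+
      \<comment> \<open>By \<open>ex\<close> at most one of the four cases applies, so removing one
        vertex settles them all. If none applies, an arbitrary element is removed, so that exactly
        \<open>s\<close> vertices remain in every case.\<close>
      define x where "x = (if m \<in> I \<and> u \<in> I then m else if m + 1 \<in> I \<and> v \<in> I then m + 1
        else if m + 2 \<in> I then m + 2 else if m + 3 \<in> I then m + 3 else SOME x. x \<in> I)"
      have xI: "x \<in> I"
        using \<open>I \<noteq> {}\<close> by (simp add: x_def some_in_eq)
      have "m + 2 \<notin> I - {x}" "m + 3 \<notin> I - {x}"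
        using ex by (auto simp: x_def)
      moreover have "y < m + 2 \<or> y = m + 2 \<or> y = m + 3" if "y \<in> I" for y
        using I that by force
      ultimately have sub: "I - {x} \<subseteq> {..<m + 2}"
        by blast
      have "\<not> (m \<in> I - {x} \<and> u \<in> I - {x})" "\<not> (m + 1 \<in> I - {x} \<and> v \<in> I - {x})"
        using ex by (auto simp: x_def)
      then have "inj_on \<pi> (I - {x})"
        using uv ex by (auto simp: inj_on_def \<pi>_def)
      with sub xI show ?thesis by blast
    qed
    then obtain x where x: "x \<in> I" "I - {x} \<subseteq> {..<m + 2}" "inj_on \<pi> (I - {x})"
      by blast
    define S where "S = \<pi> ` (I - {x})"
    have S: "S \<subseteq> {..<m}" "card S = s"
      using x I \<open>finite I\<close> pi by (auto simp: S_def card_image)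
    \<comment> \<open>A pair with an edge of \<open>c\<close> as its image fails to be an edge of
      \<open>c'\<close> only if it was removed by hand, and both removed pairs project to
      \<open>{u, v}\<close>.\<close>
    have only: "{a, b} = {u, v}" if "a \<in> S" "b \<in> S" "a \<noteq> b" "c {a, b}" for a b
    proof -
      obtain y z where yz: "y \<in> I" "z \<in> I" "y < m + 2" "z < m + 2" "a = \<pi> y" "b = \<pi> z"
        using \<open>a \<in> S\<close> \<open>b \<in> S\<close> x(2) unfolding S_def by blast
      then have "\<not> c' {y, z}"
        using excl that(3) by blast
      then have "{y, z} = {u, v} \<or> {y, z} = {m, m + 1}"
        using low yz that by blast
      then have "\<pi> ` {y, z} = \<pi> ` {u, v} \<or> \<pi> ` {y, z} = \<pi> ` {m, m + 1}"
        by metis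
      then show ?thesis
        using yz uv by (auto simp: \<pi>_def)
    qed
    have "near_independent c S"
    proof (cases "u \<in> S \<and> v \<in> S")
      case True
      then show ?thesis
        using only uv unfolding near_independent_def by (intro bexI[of _ u] bexI[of _ v]) auto
    next
      case False
      then have "independent c S"
        using only unfolding independent_def by (metis insert_iff singletonD)
      then show ?thesis
        using S s independent_imp_near_independent by simp
    qed
    with J S show False by blast
  qed
  ultimately show ?thesis by blast
qed

section \<open>Small cases and the inequality\<close>

lemma not_arrows_le_5:
  assumes "n \<le> 5" "k \<ge> 3"
  shows "\<not> arrows n (complete_graph 3) (complete_graph k)"
proof
  assume arr: "arrows n (complete_graph 3) (complete_graph k)"
  \<comment> \<open>The pentagon, restricted to the first \<open>n\<close> vertices: neither it nor
    its complement contains a triangle.\<close>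
  define c :: "nat set \<Rightarrow> bool" where "c = (\<lambda>e. e \<in> {{0, 1}, {1, 2}, {2, 3}, {3, 4}, {4, 0}})"
  have lt5: "x = 0 \<or> x = 1 \<or> x = 2 \<or> x = 3 \<or> x = 4" if "x < n" for x
    using that assms(1) by auto
  have "triangle_free n c"
    unfolding triangle_free_def
  proof (intro allI impI notI)
    fix x y z
    assume "x < n" "y < n" "z < n" and xyz: "x \<noteq> y" "y \<noteq> z" "x \<noteq> z" "c {x, y}" "c {y, z}" "c {x, z}"
    show False
      using lt5[OF \<open>x < n\<close>] lt5[OF \<open>y < n\<close>] lt5[OF \<open>z < n\<close>] xyz
      by (elim disjE) (simp_all add: c_def doubleton_eq_iff)
  qed
  then obtain I where I: "I \<subseteq> {..<n}" "card I = k" "independent c I"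
    using arr arrows_complete_graph_iff by blast
  then obtain T where "T \<subseteq> I" "card T = 3"
    using obtain_subset_with_card_n[of 3 I] assms(2) by metis
  then obtain x y z where xyz: "x \<in> I" "y \<in> I" "z \<in> I" "x \<noteq> y" "y \<noteq> z" "x \<noteq> z"
    by (auto simp: card_3_iff)
  then have "x < n" "y < n" "z < n" and "\<not> c {x, y}" "\<not> c {y, z}" "\<not> c {x, z}"
    using I by (auto simp: independent_def)
  then show False
    using lt5[OF \<open>x < n\<close>] lt5[OF \<open>y < n\<close>] lt5[OF \<open>z < n\<close>] xyz(4-6)
    by (elim disjE) (simp_all add: c_def doubleton_eq_iff)
qed

lemma not_arrows_add_4:
  assumes s: "s \<ge> 2" and e: "e \<in> edges (complete_graph s)" and m: "m \<ge> 2"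
    and narr: "\<not> arrows m (complete_graph 3) (delete_edge (complete_graph s) e)"
  shows "\<not> arrows (m + 4) (complete_graph 3) (complete_graph (s + 1))"
proof -
  obtain c where tf: "triangle_free m c"
    and J: "\<And>I. I \<subseteq> {..<m} \<Longrightarrow> card I = s \<Longrightarrow> \<not> near_independent c I"
    using narr contains_delete_edge[OF e] unfolding arrows_def contains_triangle_iff by blast
  have "\<exists>c'. triangle_free (m + 4) c' \<and> (\<forall>I\<subseteq>{..<m + 4}. card I = s + 1 \<longrightarrow> \<not> independent c' I)"
  proof (cases "\<exists>u<m. \<exists>v<m. u \<noteq> v \<and> c {u, v}")
    case True
    then show ?thesis
      using extend_by_four[OF tf J] s by blast
  next
    case False
    have "m < s"
    proof (rule ccontr)
      assume "\<not> m < s"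
      then have sub: "{..<s} \<subseteq> {..<m}"
        by auto
      then have "independent c {..<s}"
        using False unfolding independent_def by (meson lessThan_iff subsetD)
      then show False
        using J[OF sub] independent_imp_near_independent[of c "{..<s}"] s by simp
    qed
    \<comment> \<open>No subset has \<open>s\<close> elements, so every colouring of these
      \<open>m\<close> vertices meets the condition on near-independent sets. A colouring with the
      single edge \<open>{0, 1}\<close> can thus replace \<open>c\<close>; both ends exist because
      \<open>m \<ge> 2\<close>.\<close>
    then have small: "\<not> near_independent c' I" if "I \<subseteq> {..<m}" "card I = s" for c' I
      using card_mono[OF _ that(1)] that(2) by simp
    have "triangle_free m (\<lambda>e. e = {0, 1})"
      by (auto simp: triangle_free_def doubleton_eq_iff)
    then show ?thesis
      using extend_by_four[of m "\<lambda>e. e = {0, 1}" s 0 1] small m s by auto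
  qed
  then show ?thesis
    unfolding arrows_complete_graph_iff by blast
qed

theorem corollary7:
  fixes s :: nat and e :: "nat set"
  assumes "s \<ge> 2" and "e \<in> edges (complete_graph s)"
  shows "ramsey_number (complete_graph 3) (complete_graph (s + 1))
    \<ge> ramsey_number (complete_graph 3) (delete_edge (complete_graph s) e) + 4"
proof (rule ccontr)
  define M where "M = ramsey_number (complete_graph 3) (complete_graph (s + 1))"
  assume "\<not> ?thesis"
  then have lt: "M < ramsey_number (complete_graph 3) (delete_edge (complete_graph s) e) + 4"
    by (simp add: M_def)
  have arr: "arrows M (complete_graph 3) (complete_graph (s + 1))"
    using LeastI_ex[OF arrows_exists[OF simple_graph_complete[of 3] simple_graph_complete[of "s + 1"]]]
    by (simp add: M_def ramsey_number_def)
  \<comment> \<open>This keeps the subtraction \<open>M - 4\<close> from truncating and gives the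
    two vertices that the extension requires.\<close>
  then have "M > 5"
    using not_arrows_le_5[of M "s + 1"] assms(1) by force
  then have "M - 4 \<ge> 2" "M - 4 < ramsey_number (complete_graph 3) (delete_edge (complete_graph s) e)"
    using lt by auto
  \<comment> \<open>Minimality applies because \<open>M - 4\<close> also satisfies the side
    condition \<open>n \<ge> 1\<close> of the least number.\<close>
  then have "\<not> arrows (M - 4) (complete_graph 3) (delete_edge (complete_graph s) e)"
    unfolding ramsey_number_def by (auto dest: not_less_Least)
  then have "\<not> arrows (M - 4 + 4) (complete_graph 3) (complete_graph (s + 1))"
    using not_arrows_add_4 assms \<open>M - 4 \<ge> 2\<close> by blast
  then show False
    using arr \<open>M > 5\<close> by simp
qed

end
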